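(* For all integers $m\ge 1$ and $n$ with $m\le n\le \frac{38}{25}m$, we have $M(m,n)=m+n-1$; that is, the tape merge algorithm is optimal in the worst case for merging sorted lists of sizes $m$ and $n$.
   Context: Let $a_1<a_2<\cdots<a_m$ and $b_1<b_2<\cdots<b_n$ be two sorted lists whose $m+n$ elements are distinct and whose relative interleaving is unknown. A (deterministic) merging algorithm obtains information only through pairwise comparisons between elements and must determine the complete linear order of all $m+n$ elements. $M(m,n)$ denotes the minimum, over all such algorithms, of the number of comparisons the algorithm uses in the worst case. Tape merge (repeatedly compare the two smallest remaining elements and output the smaller) uses $m+n-1$ comparisons in the worst case, so $M(m,n)\le m+n-1$. *)

theory Defs
  imports Complex_Main
begin

text \<open>The element \<open>a\<^sub>i\<close> (resp. \<open>b\<^sub>j\<close>) of the informal problem is named \<open>A (i - 1)\<close> (resp. \<open>B (j - 1)\<close>):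
  indices start at 0.\<close>

datatype elem = A nat | B nat

definition elems :: "nat \<Rightarrow> nat \<Rightarrow> elem set" where
  "elems m n = A ` {..<m} \<union> B ` {..<n}"

text \<open>An input assigns values to the elements. Only the relative order of the values matters;
  as there are finitely many elements, real values realise every interleaving.\<close>

definition inputs :: "nat \<Rightarrow> nat \<Rightarrow> (elem \<Rightarrow> real) set" where
  "inputs m n = {v. strict_mono_on {..<m} (\<lambda>i. v (A i)) \<and> strict_mono_on {..<n} (\<lambda>j. v (B j)) \<and>
                    inj_on v (elems m n)}"

text \<open>A deterministic comparison algorithm is a decision tree. \<open>Compare x y l r\<close> compares \<open>x\<close> with \<open>y\<close>,
  two arbitrary elements (possibly of the same list), and continues with \<open>l\<close> if \<open>x\<close> is the smaller
  one and with \<open>r\<close> otherwise. \<open>Output xs\<close> announces the elements in increasing order.\<close>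

datatype algorithm = Output "elem list" | Compare elem elem algorithm algorithm

primrec queries :: "algorithm \<Rightarrow> elem set" where
  "queries (Output xs) = {}"
| "queries (Compare x y l r) = {x, y} \<union> queries l \<union> queries r"

primrec result :: "algorithm \<Rightarrow> (elem \<Rightarrow> real) \<Rightarrow> elem list" where
  "result (Output xs) v = xs"
| "result (Compare x y l r) v = (if v x < v y then result l v else result r v)"

primrec comparisons :: "algorithm \<Rightarrow> (elem \<Rightarrow> real) \<Rightarrow> nat" where
  "comparisons (Output xs) v = 0"
| "comparisons (Compare x y l r) v = Suc (if v x < v y then comparisons l v else comparisons r v)"

definition merging_algorithm :: "nat \<Rightarrow> nat \<Rightarrow> algorithm \<Rightarrow> bool" where
  "merging_algorithm m n t \<longleftrightarrow> queries t \<subseteq> elems m n \<and>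
     (\<forall>v \<in> inputs m n. set (result t v) = elems m n \<and>
                       sorted_wrt (\<lambda>x y. v x < v y) (result t v))"

text \<open>The maximum is over a nonempty set of numbers bounded by the height of \<open>t\<close>.\<close>

definition worst_case :: "nat \<Rightarrow> nat \<Rightarrow> algorithm \<Rightarrow> nat" where
  "worst_case m n t = Max (comparisons t ` inputs m n)"

definition M :: "nat \<Rightarrow> nat \<Rightarrow> nat" where
  "M m n = (LEAST k. \<exists>t. merging_algorithm m n t \<and> worst_case m n t = k)"

text \<open>In \<open>tape out xs ys\<close>, \<open>out\<close> has already been output, and \<open>xs\<close> and \<open>ys\<close> are what remains of the
  two lists.\<close>

fun tape :: "elem list \<Rightarrow> elem list \<Rightarrow> elem list \<Rightarrow> algorithm" where
  "tape out [] ys = Output (out @ ys)"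
| "tape out xs [] = Output (out @ xs)"
| "tape out (x # xs) (y # ys) =
     Compare x y (tape (out @ [x]) xs (y # ys)) (tape (out @ [y]) (x # xs) ys)"

definition tape_merge :: "nat \<Rightarrow> nat \<Rightarrow> algorithm" where
  "tape_merge m n = tape [] (map A [0..<m]) (map B [0..<n])"

end

theory Submission imports Defs
begin

text \<open>
  The lower bound is an adversary argument in the style of Knuth. Write an interleaving as the
  nondecreasing function \<open>h\<close> for which \<open>h i\<close> is the number of elements \<open>B j\<close> below \<open>A i\<close>. Every
  correct algorithm has to compare each pair of elements of different lists that are neighbours in
  the final order. The adversary keeps the input divided into consecutive blocks and answers a
  comparison inside a block by cutting that block in two, such that the compared elements are
  separated by the cut. Cutting between two elements preserves the total number of comparisons that
  would make tape merge optimal. Alternatively an element \<open>B l\<close> is put into both parts, as the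
  largest element of the first one and as the smallest element of the second one; such a cut gains
  one comparison, but the two parts become constrained.

  If \<open>m + n - 1 - d\<close> comparisons can be forced in a block with \<open>m\<close> and \<open>n\<close> elements, we say that its
  deficit is at most \<open>d\<close>. For each kind of constraint and each \<open>d \<le> 2\<close> the deficit is at most \<open>d\<close> as long as
  \<open>25 n \<le> 38 m + c\<close>, for a constant \<open>c\<close> depending on the constraint and on \<open>d\<close>. The constants are chosen
  such that these nine statements can be proved by a simultaneous induction. Since the
  deficit does not increase from \<open>(m, n)\<close> to \<open>(m + 1, n + 1)\<close>, only the sizes next to the line of slope
  \<open>38 / 25\<close> have to be considered in the induction step.
\<close>

section \<open>Blocks with small deficit\<close>

text \<open>\<open>forces L R m n d\<close>: at least \<open>m + n - 1 - d\<close> comparisons can be forced in a block of \<open>m\<close> elements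
  \<open>A i\<close> and \<open>n\<close> elements \<open>B j\<close> while committing to a \<open>B\<close> as its smallest (\<open>L\<close>) or largest (\<open>R\<close>) element.
  The algorithm does not know about \<open>L\<close> and \<open>R\<close>: it still has to verify them.
  The flag \<open>e\<close> of a cut tells whether both parts share the element \<open>B l\<close>.\<close>

inductive forces :: "bool \<Rightarrow> bool \<Rightarrow> nat \<Rightarrow> nat \<Rightarrow> nat \<Rightarrow> bool" where
  one_sided: "forces L R m n d"
    if "m = 0 \<or> n = 0" "0 < m + n" "m + n \<le> d + 1" "n = 0 \<Longrightarrow> \<not> L \<and> \<not> R"
| cut: "forces L R m n d"
    if "0 < m" "0 < n"
      "\<And>i j. i < m \<Longrightarrow> j < n \<Longrightarrow> \<exists>k l k' l' e d1 d2. m = k + k' \<and> n = l + l' \<and>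
         (i < k \<and> l + of_bool e \<le> j \<or> k \<le> i \<and> j < l) \<and>
         forces L e k (l + of_bool e) d1 \<and> forces e R k' l' d2 \<and> d1 + d2 \<le> d + of_bool e"

lemma forces_constraint: "forces L R m n d \<Longrightarrow> L \<or> R \<Longrightarrow> 0 < n"
  by (erule forces.cases) auto

lemma cutI:
  assumes "m = k + k'" "n = l + l'" "i < k \<and> l + of_bool e \<le> j \<or> k \<le> i \<and> j < l"
    "forces L e k (l + of_bool e) d1" "forces e R k' l' d2" "d1 + d2 \<le> d + of_bool e"
  shows "\<exists>k l k' l' e d1 d2. m = k + k' \<and> n = l + l' \<and>
         (i < k \<and> l + of_bool e \<le> j \<or> k \<le> i \<and> j < l) \<and>
         forces L e k (l + of_bool e) d1 \<and> forces e R k' l' d2 \<and> d1 + d2 \<le> d + of_bool e"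
  using assms by blast

section \<open>Monotonicity, reversal and small blocks\<close>

lemma forces_mono:
  assumes "forces L R m n d" "d \<le> d'"
  shows "forces L R m n d'"
  using assms(1)
proof cases
  case one_sided
  then show ?thesis using assms(2) by (intro forces.one_sided) auto
next
  case cut
  show ?thesis
  proof (rule forces.cut)
    fix i j assume "i < m" "j < n"
    from cut(3)[OF this] obtain k l k' l' e d1 d2 where "m = k + k'" "n = l + l'"
      "i < k \<and> l + of_bool e \<le> j \<or> k \<le> i \<and> j < l"
      "forces L e k (l + of_bool e) d1" "forces e R k' l' d2" "d1 + d2 \<le> d + of_bool e"
      by blast
    then show "\<exists>k l k' l' e d1 d2. m = k + k' \<and> n = l + l' \<and>
         (i < k \<and> l + of_bool e \<le> j \<or> k \<le> i \<and> j < l) \<and>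
         forces L e k (l + of_bool e) d1 \<and> forces e R k' l' d2 \<and> d1 + d2 \<le> d' + of_bool e"
      using assms(2) by - (rule cutI; assumption?; linarith)
  qed (use cut in auto)
qed

text \<open>A constraint only narrows the admissible interleavings, so the same cuts work without
  it. Needed when a part appended at the end takes over the constraint \<open>R\<close>.\<close>

lemma forces_drop_right: "forces L R m n d \<Longrightarrow> forces L False m n d"
proof (induction rule: forces.induct)
  case (one_sided m n d L R)
  then show ?case by (intro forces.one_sided) auto
next
  case (cut m n L R d)
  show ?case
    by (rule forces.cut) (use cut in \<open>blast+\<close>)
qed

lemma forces_reverse: "forces L R m n d \<Longrightarrow> forces R L m n d"
proof (induction rule: forces.induct)
  case (one_sided m n d L R)
  then show ?case by (intro forces.one_sided) auto
next
  case (cut m n L R d)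
  show ?case
  proof (rule forces.cut)
    fix i j assume ij: "i < m" "j < n"
    then obtain k l k' l' e d1 d2 where c: "m = k + k'" "n = l + l'"
      "m - Suc i < k \<and> l + of_bool e \<le> n - Suc j \<or> k \<le> m - Suc i \<and> n - Suc j < l"
      "forces e L k (l + of_bool e) d1" "forces R e k' l' d2" "d1 + d2 \<le> d + of_bool e"
      using cut.IH[of "m - Suc i" "n - Suc j"] by force
    from c(5) have l': "of_bool e \<le> l'"
      using forces_constraint[OF c(5)] by (cases e) auto
    show "\<exists>k l k' l' e d1 d2. m = k + k' \<and> n = l + l' \<and>
         (i < k \<and> l + of_bool e \<le> j \<or> k \<le> i \<and> j < l) \<and>
         forces R e k (l + of_bool e) d1 \<and> forces e L k' l' d2 \<and> d1 + d2 \<le> d + of_bool e"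
    \<comment> \<open>A shared \<open>B\<close> is the first of the \<open>l'\<close> elements of
      the second part. After reversal it is the last one of the first part, so only
      \<open>l' - of_bool e\<close> elements precede it.\<close>
    proof (intro exI conjI)
      show "m = k' + k" "n = (l' - of_bool e) + (l + of_bool e)" using c l' by auto
      show "i < k' \<and> l' - of_bool e + of_bool e \<le> j \<or> k' \<le> i \<and> j < l' - of_bool e"
        using ij c(1-3) l' by auto
      show "forces R e k' (l' - of_bool e + of_bool e) d2" using c l' by simp
      show "forces e L k (l + of_bool e) d1" "d2 + d1 \<le> d + of_bool e" using c by simp_all
    qed
  qed (use cut in auto)
qed

lemma forces_A: "0 < m \<Longrightarrow> m \<le> d + 1 \<Longrightarrow> forces False False m 0 d"
  by (rule one_sided) auto

lemma forces_B: "0 < n \<Longrightarrow> n \<le> d + 1 \<Longrightarrow> forces L R 0 n d"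
  by (rule one_sided) auto

text \<open>Since \<open>n - d\<close> is at most 1, one comparison suffices: the answer puts the
  \<open>A\<close> above all \<open>B\<close>s and leaves two one-sided blocks.\<close>

lemma forces_one_A:
  assumes "0 < n" "n \<le> d + 1" shows "forces L False 1 n d"
proof (rule cut)
  fix i j assume "i < (1::nat)" "j < n"
  then show "\<exists>k l k' l' e d1 d2. 1 = k + k' \<and> n = l + l' \<and>
         (i < k \<and> l + of_bool e \<le> j \<or> k \<le> i \<and> j < l) \<and>
         forces L e k (l + of_bool e) d1 \<and> forces e False k' l' d2 \<and> d1 + d2 \<le> d + of_bool e"
    using assms by - (rule cutI[of _ 0 1 _ n 0 _ False _ _ d _ 0]; auto intro: forces_A forces_B)
qed (use assms in auto)

lemma forces_one_B:
  assumes "0 < m" "m \<le> d + 1" shows "forces False R m 1 d"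
proof (rule cut)
  fix i j assume "i < m" "j < (1::nat)"
  then show "\<exists>k l k' l' e d1 d2. m = k + k' \<and> 1 = l + l' \<and>
         (i < k \<and> l + of_bool e \<le> j \<or> k \<le> i \<and> j < l) \<and>
         forces False e k (l + of_bool e) d1 \<and> forces e R k' l' d2 \<and> d1 + d2 \<le> d + of_bool e"
    using assms by - (rule cutI[of _ m 0 _ 0 1 _ False _ _ d _ 0]; auto intro: forces_A forces_B)
qed (use assms in auto)

text \<open>Every cut of an \<open>m\<close> by \<open>n\<close> block becomes a cut of the larger block by enlarging its second or
  its first part; only the comparisons in the two remote corners need a cut of their own.\<close>

lemma forces_Suc_Suc: "forces L R m n d \<Longrightarrow> forces L R (Suc m) (Suc n) d"
proof (induction rule: forces.induct)
  case (one_sided m n d L R)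
  show ?case
  proof (rule forces.cut)
    fix i j assume ij: "i < Suc m" "j < Suc n"
    show "\<exists>k l k' l' e d1 d2. Suc m = k + k' \<and> Suc n = l + l' \<and>
         (i < k \<and> l + of_bool e \<le> j \<or> k \<le> i \<and> j < l) \<and>
         forces L e k (l + of_bool e) d1 \<and> forces e R k' l' d2 \<and> d1 + d2 \<le> d + of_bool e"
    proof (cases "m = 0")
      case True
      then show ?thesis
        using one_sided ij forces_one_A[of n d L] forces_one_B[of 1 0 R]
        by - (cases "j < n",
            (rule cutI[of _ 0 1 _ n 1 _ False _ _ d _ 0]; auto intro: forces_B),
            (rule cutI[of _ 1 0 _ n 1 _ False _ _ d _ 0]; auto intro: forces_B))
    next
      case False
      then have z: "n = 0" "0 < m" "m \<le> d + 1" "\<not> L" "\<not> R" using one_sided by auto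
      show ?thesis
      proof (cases "i < m")
        case True
        then show ?thesis
          using z ij forces_one_A[of 1 0 False]
          by - (rule cutI[of _ m 1 _ 0 1 _ False _ _ d _ 0]; auto intro: forces_A)
      next
        case False
        then show ?thesis
          using z ij forces_one_B[of m d False]
          by - (rule cutI[of _ m 1 _ 1 0 _ False _ _ d _ 0]; auto intro: forces_A)
      qed
    qed
  qed auto
next
  case (cut m n L R d)
  have LR: "forces L R m n d" by (rule forces.cut) (use cut in blast)+
  show ?case
  proof (rule forces.cut)
    fix i j assume ij: "i < Suc m" "j < Suc n"
    consider "i < m" "j < n" | "0 < i" "0 < j" | "i = 0" "j = n" | "i = m" "j = 0"
      using ij cut(1,2) by (auto simp: less_Suc_eq)
    then show "\<exists>k l k' l' e d1 d2. Suc m = k + k' \<and> Suc n = l + l' \<and>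
         (i < k \<and> l + of_bool e \<le> j \<or> k \<le> i \<and> j < l) \<and>
         forces L e k (l + of_bool e) d1 \<and> forces e R k' l' d2 \<and> d1 + d2 \<le> d + of_bool e"
    proof cases
      case 1
      from cut.IH[OF this] obtain k l k' l' e d1 d2 where "m = k + k'" "n = l + l'"
        "i < k \<and> l + of_bool e \<le> j \<or> k \<le> i \<and> j < l"
        "forces L e k (l + of_bool e) d1" "forces e R (Suc k') (Suc l') d2" "d1 + d2 \<le> d + of_bool e"
        by blast
      then show ?thesis by - (rule cutI[of _ k "Suc k'" _ l "Suc l'"]; auto)
    next
      case 2
      then have "i - 1 < m" "j - 1 < n" using ij by auto
      from cut.IH[OF this] obtain k l k' l' e d1 d2 where "m = k + k'" "n = l + l'"
        "i - 1 < k \<and> l + of_bool e \<le> j - 1 \<or> k \<le> i - 1 \<and> j - 1 < l"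
        "forces L e (Suc k) (Suc (l + of_bool e)) d1" "forces e R k' l' d2" "d1 + d2 \<le> d + of_bool e"
        by blast
      then show ?thesis using 2 by - (rule cutI[of _ "Suc k" k' _ "Suc l" l']; auto)
    next
      case 3
      then show ?thesis
        using cut(1,2) forces_drop_right[OF LR] forces_one_B[of 1 0 R]
        by - (rule cutI[of _ m 1 _ n 1 _ False _ _ d _ 0]; auto)
    next
      case 4
      then show ?thesis
        using cut(1,2) forces_drop_right[OF LR] forces_one_B[of 1 0 R]
        by - (rule cutI[of _ m 1 _ n 1 _ False _ _ d _ 0]; auto)
    qed
  qed auto
qed

section \<open>The induction along the line of slope 38 / 25\<close>

text \<open>The table was found by a computer search: it is close to the largest one for which the statements
  below can be proved from each other. Index \<open>t\<close> counts the constraints \<open>L\<close> and \<open>R\<close>.\<close>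

definition bound :: "nat \<Rightarrow> nat \<Rightarrow> int" where
  "bound t d = [[32, 17, - 16], [79, 72, 65], [111, 111, 110]] ! d ! t"

text \<open>The case \<open>m = 0\<close> is the one-sided base case; otherwise at least
  \<open>m - 1\<close> elements \<open>B\<close> remain besides the \<open>t\<close> committed ones.
  Integers keep the differences in cuts untruncated.\<close>

definition region :: "nat \<Rightarrow> nat \<Rightarrow> int \<Rightarrow> int \<Rightarrow> bool" where
  "region t d m n \<longleftrightarrow>
     m = 0 \<and> 1 \<le> n \<and> n \<le> int d + 1 \<or>
     1 \<le> m \<and> m + int t \<le> n + 1 \<and> 25 * n \<le> 38 * m + bound t d"

definition splits :: "bool \<Rightarrow> bool \<Rightarrow> nat \<Rightarrow> int \<Rightarrow> int \<Rightarrow> int \<Rightarrow> int \<Rightarrow> bool \<Rightarrow> nat \<Rightarrow> nat \<Rightarrow> bool" where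
  "splits L R d m n k l e d1 d2 \<longleftrightarrow>
     0 \<le> l \<and> l + of_bool e \<le> n \<and> d1 \<le> 2 \<and> d2 \<le> 2 \<and> d1 + d2 \<le> d + of_bool e \<and>
     region (of_bool L + of_bool e) d1 k (l + of_bool e) \<and>
     region (of_bool e + of_bool R) d2 (m - k) (n - l)"

text \<open>A height \<open>l\<close> that settles row \<open>i\<close>: a comparison of \<open>A i\<close> with \<open>B j\<close> is answered by \<open>A i < B j\<close> and a cut after
  row \<open>i\<close> if \<open>l \<le> j\<close>, and by \<open>A i > B j\<close> and a cut before row \<open>i\<close> if \<open>j < l\<close>.\<close>

definition crossing :: "bool \<Rightarrow> bool \<Rightarrow> nat \<Rightarrow> int \<Rightarrow> int \<Rightarrow> int \<Rightarrow> int \<Rightarrow> bool" where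
  "crossing L R d m n i l \<longleftrightarrow> 0 \<le> l \<and> l \<le> n \<and>
     (l = n \<or> (\<exists>e d1 d2. splits L R d m n (i + 1) (l - of_bool e) e d1 d2)) \<and>
     (l = 0 \<or> (\<exists>e d1 d2. splits L R d m n i l e d1 d2))"

text \<open>The empty block lies in no region, so a block of size 1 by 1 cannot be reached
  diagonally; it is excluded here as a base case.\<close>

definition extreme :: "nat \<Rightarrow> nat \<Rightarrow> int \<Rightarrow> int \<Rightarrow> bool" where
  "extreme t d m n \<longleftrightarrow> 1 \<le> m \<and> 1 \<le> n \<and> region t d m n \<and> \<not> region t d (m - 1) (n - 1) \<and>
     \<not> (m = 1 \<and> n = 1)"

lemma multiple_above: obtains l :: int where "x \<le> 25 * l" "25 * l < x + 25"
proof
  show "x \<le> 25 * (- ((- x) div 25))" by presburger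
  show "25 * (- ((- x) div 25)) < x + 25" by presburger
qed

text \<open>The height \<open>l\<close> is the first one above a line of slope \<open>38 / 25\<close>, whose offset was found by a computer
  search; where no single offset serves all rows there are two candidates \<open>a\<close> and \<open>b\<close>.\<close>

declare [[smt_timeout = 300]]

lemma crossing_FF_0:
  assumes "extreme 0 0 m n" "0 \<le> i" "i < m"
  shows "\<exists>l. crossing False False 0 m n i l"
proof (rule ccontr)
  assume neg: "\<nexists>l. crossing False False 0 m n i l"
  \<comment> \<open>The largest height with \<open>25 * (l + 1) \<le> 38 * i + 72\<close>, the bound
    for the first part of the cut before row \<open>i\<close>.\<close>
  obtain l where l: "38 * (i + 1) - 15 \<le> 25 * l" "25 * l < 38 * (i + 1) - 15 + 25"
    by (rule multiple_above)
  \<comment> \<open>Fixing \<open>e\<close>, \<open>d1\<close> and \<open>d2\<close> leaves linear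
    integer arithmetic without quantifiers. In both cuts the shared \<open>B\<close> pays for the
    part of deficit 1.\<close>
  have not_l: "\<not> (0 \<le> l \<and> l \<le> n \<and>
      (l = n \<or>
       splits False False 0 m n (i + 1) (l - of_bool True) True 0 1) \<and>
      (l = 0 \<or>
       splits False False 0 m n i l True 1 0))"
    using neg unfolding crossing_def by blast
  show False
    using assms l not_l by (simp add: splits_def extreme_def region_def bound_def numeral_2_eq_2) (smt (z3))
qed

lemma crossing_FT_0:
  assumes "extreme 1 0 m n" "0 \<le> i" "i < m"
  shows "\<exists>l. crossing False True 0 m n i l"
proof (rule ccontr)
  assume neg: "\<nexists>l. crossing False True 0 m n i l"
  \<comment> \<open>The offset is measured from the constrained end \<open>(m, n)\<close>:
    \<open>l\<close> is the least height at which the second part of the shared cut after row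
    \<open>i\<close> satisfies the bound 65.\<close>
  obtain l where l: "38 * (i + 1) + 25 * n - 38 * m - 40 \<le> 25 * l" "25 * l < 38 * (i + 1) + 25 * n - 38 * m - 40 + 25"
    by (rule multiple_above)
  have not_l: "\<not> (0 \<le> l \<and> l \<le> n \<and>
      (l = n \<or>
       splits False True 0 m n (i + 1) (l - of_bool True) True 0 1) \<and>
      (l = 0 \<or>
       splits False True 0 m n i l False 0 0 \<or>
       splits False True 0 m n i l True 1 0))"
    using neg unfolding crossing_def by blast
  show False
    using assms l not_l by (simp add: splits_def extreme_def region_def bound_def numeral_2_eq_2) (smt (z3))
qed

lemma crossing_FF_1:
  assumes "extreme 0 1 m n" "0 \<le> i" "i < m"
  shows "\<exists>l. crossing False False 1 m n i l"
proof (rule ccontr)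
  assume neg: "\<nexists>l. crossing False False 1 m n i l"
  obtain l where l: "38 * (i + 1) + 5 \<le> 25 * l" "25 * l < 38 * (i + 1) + 5 + 25"
    by (rule multiple_above)
  have not_l: "\<not> (0 \<le> l \<and> l \<le> n \<and>
      (l = n \<or>
       splits False False 1 m n (i + 1) (l - of_bool False) False 0 1) \<and>
      (l = 0 \<or>
       splits False False 1 m n i l False 1 0 \<or>
       splits False False 1 m n i l True 1 1))"
    using neg unfolding crossing_def by blast
  show False
    using assms l not_l by (simp add: splits_def extreme_def region_def bound_def numeral_2_eq_2) (smt (z3))
qed

lemma crossing_FT_1:
  assumes "extreme 1 1 m n" "0 \<le> i" "i < m"
  shows "\<exists>l. crossing False True 1 m n i l"
proof (rule ccontr)
  assume neg: "\<nexists>l. crossing False True 1 m n i l"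
  obtain a where a: "38 * (i + 1) - 33 \<le> 25 * a" "25 * a < 38 * (i + 1) - 33 + 25"
    by (rule multiple_above)
  have not_a: "\<not> (0 \<le> a \<and> a \<le> n \<and>
      (a = n \<or>
       splits False True 1 m n (i + 1) (a - of_bool True) True 0 2) \<and>
      (a = 0 \<or>
       splits False True 1 m n i a True 1 1))"
    using neg unfolding crossing_def by blast
  obtain b where b: "38 * (i + 1) + 12 \<le> 25 * b" "25 * b < 38 * (i + 1) + 12 + 25"
    by (rule multiple_above)
  have not_b: "\<not> (0 \<le> b \<and> b \<le> n \<and>
      (b = n \<or>
       splits False True 1 m n (i + 1) (b - of_bool False) False 0 1 \<or>
       splits False True 1 m n (i + 1) (b - of_bool True) True 1 1) \<and>
      (b = 0 \<or>
       splits False True 1 m n i b False 1 0))"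
    using neg unfolding crossing_def by blast
  show False
    using assms a not_a b not_b by (simp add: splits_def extreme_def region_def bound_def numeral_2_eq_2) (smt (z3))
qed

lemma crossing_TT_1:
  assumes "extreme 2 1 m n" "0 \<le> i" "i < m"
  shows "\<exists>l. crossing True True 1 m n i l"
proof (rule ccontr)
  assume neg: "\<nexists>l. crossing True True 1 m n i l"
  obtain a where a: "38 * (i + 1) - 25 \<le> 25 * a" "25 * a < 38 * (i + 1) - 25 + 25"
    by (rule multiple_above)
  have not_a: "\<not> (0 \<le> a \<and> a \<le> n \<and>
      (a = n \<or>
       splits True True 1 m n (i + 1) (a - of_bool False) False 0 1) \<and>
      (a = 0 \<or>
       splits True True 1 m n i a True 1 1))"
    using neg unfolding crossing_def by blast
  obtain b where b: "38 * (i + 1) + 10 \<le> 25 * b" "25 * b < 38 * (i + 1) + 10 + 25"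
    by (rule multiple_above)
  have not_b: "\<not> (0 \<le> b \<and> b \<le> n \<and>
      (b = n \<or>
       splits True True 1 m n (i + 1) (b - of_bool False) False 0 1 \<or>
       splits True True 1 m n (i + 1) (b - of_bool True) True 1 1) \<and>
      (b = 0 \<or>
       splits True True 1 m n i b False 1 0))"
    using neg unfolding crossing_def by blast
  show False
    using assms a not_a b not_b by (simp add: splits_def extreme_def region_def bound_def numeral_2_eq_2) (smt (z3))
qed

lemma crossing_FF_2:
  assumes "extreme 0 2 m n" "0 \<le> i" "i < m"
  shows "\<exists>l. crossing False False 2 m n i l"
proof (rule ccontr)
  assume neg: "\<nexists>l. crossing False False 2 m n i l"
  obtain a where a: "38 * (i + 1) - 12 \<le> 25 * a" "25 * a < 38 * (i + 1) - 12 + 25"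
    by (rule multiple_above)
  have not_a: "\<not> (0 \<le> a \<and> a \<le> n \<and>
      (a = n \<or>
       splits False False 2 m n (i + 1) (a - of_bool False) False 0 2) \<and>
      (a = 0 \<or>
       splits False False 2 m n i a True 2 1))"
    using neg unfolding crossing_def by blast
  obtain b where b: "38 * (i + 1) + 44 \<le> 25 * b" "25 * b < 38 * (i + 1) + 44 + 25"
    by (rule multiple_above)
  have not_b: "\<not> (0 \<le> b \<and> b \<le> n \<and>
      (b = n \<or>
       splits False False 2 m n (i + 1) (b - of_bool True) True 1 2) \<and>
      (b = 0 \<or>
       splits False False 2 m n i b False 2 0))"
    using neg unfolding crossing_def by blast
  \<comment> \<open>Failure of the bound at \<open>(m - 1, n - 1)\<close> gives
    \<open>98 = 111 - 38 + 25\<close>; for \<open>m = 1\<close> it excludes \<open>n - 1\<close>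
    from 1 to 3.\<close>
  have r: "1 \<le> m" "1 \<le> n" "m + 0 \<le> n + 1" "25 * n \<le> 38 * m + 111"
    "m = 1 \<and> 5 \<le> n \<or> 2 \<le> m \<and> 38 * m + 98 < 25 * n"
    using assms(1) by (auto simp: extreme_def region_def bound_def numeral_2_eq_2)
  \<comment> \<open>In the first and the last row one part of a cut contains no \<open>A\<close> and
    falls under the other case of \<open>region\<close>.\<close>
  consider "i = 0" | "i + 1 = m" "i \<noteq> 0" | "0 < i" "i + 1 < m" using assms by linarith
  then show False
    by cases (use assms(2,3) r a not_a b not_b in
      \<open>simp add: splits_def region_def bound_def numeral_2_eq_2; smt (z3)\<close>)+
qed

lemma crossing_FT_2:
  assumes "extreme 1 2 m n" "0 \<le> i" "i < m"
  shows "\<exists>l. crossing False True 2 m n i l"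
proof (rule ccontr)
  assume neg: "\<nexists>l. crossing False True 2 m n i l"
  obtain a where a: "38 * (i + 1) \<le> 25 * a" "25 * a < 38 * (i + 1) + 25"
    by (rule multiple_above)
  have not_a: "\<not> (0 \<le> a \<and> a \<le> n \<and>
      (a = n \<or>
       splits False True 2 m n (i + 1) (a - of_bool False) False 0 2) \<and>
      (a = 0 \<or>
       splits False True 2 m n i a True 1 2 \<or>
       splits False True 2 m n i a True 2 1))"
    using neg unfolding crossing_def by blast
  obtain b where b: "38 * (i + 1) + 37 \<le> 25 * b" "25 * b < 38 * (i + 1) + 37 + 25"
    by (rule multiple_above)
  have not_b: "\<not> (0 \<le> b \<and> b \<le> n \<and>
      (b = n \<or>
       splits False True 2 m n (i + 1) (b - of_bool True) True 1 2) \<and>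
      (b = 0 \<or>
       splits False True 2 m n i b False 2 0))"
    using neg unfolding crossing_def by blast
  have r: "1 \<le> m" "1 \<le> n" "m + 1 \<le> n + 1" "25 * n \<le> 38 * m + 111"
    "m = 1 \<and> 5 \<le> n \<or> 2 \<le> m \<and> 38 * m + 98 < 25 * n"
    using assms(1) by (auto simp: extreme_def region_def bound_def numeral_2_eq_2)
  consider "i = 0" | "i + 1 = m" "i \<noteq> 0" | "0 < i" "i + 1 < m" using assms by linarith
  then show False
    by cases (use assms(2,3) r a not_a b not_b in
      \<open>simp add: splits_def region_def bound_def numeral_2_eq_2; smt (z3)\<close>)+
qed

lemma crossing_TT_2:
  assumes "extreme 2 2 m n" "0 \<le> i" "i < m"
  shows "\<exists>l. crossing True True 2 m n i l"
proof (rule ccontr)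
  assume neg: "\<nexists>l. crossing True True 2 m n i l"
  obtain a where a: "38 * (i + 1) - 12 \<le> 25 * a" "25 * a < 38 * (i + 1) - 12 + 25"
    by (rule multiple_above)
  have not_a: "\<not> (0 \<le> a \<and> a \<le> n \<and>
      (a = n \<or>
       splits True True 2 m n (i + 1) (a - of_bool False) False 0 2) \<and>
      (a = 0 \<or>
       splits True True 2 m n i a False 1 1 \<or>
       splits True True 2 m n i a True 1 2))"
    using neg unfolding crossing_def by blast
  obtain b where b: "38 * (i + 1) + 49 \<le> 25 * b" "25 * b < 38 * (i + 1) + 49 + 25"
    by (rule multiple_above)
  have not_b: "\<not> (0 \<le> b \<and> b \<le> n \<and>
      (b = n \<or>
       splits True True 2 m n (i + 1) (b - of_bool False) False 1 1 \<or>
       splits True True 2 m n (i + 1) (b - of_bool True) True 2 1) \<and>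
      (b = 0 \<or>
       splits True True 2 m n i b False 2 0))"
    using neg unfolding crossing_def by blast
  have r: "1 \<le> m" "1 \<le> n" "m + 2 \<le> n + 1" "25 * n \<le> 38 * m + 110"
    "m = 1 \<and> 5 \<le> n \<or> 2 \<le> m \<and> 38 * m + 97 < 25 * n"
    using assms(1) by (auto simp: extreme_def region_def bound_def numeral_2_eq_2)
  consider "i = 0" | "i + 1 = m" "i \<noteq> 0" | "0 < i" "i + 1 < m" using assms by linarith
  then show False
    by cases (use assms(2,3) r a not_a b not_b in
      \<open>simp add: splits_def region_def bound_def numeral_2_eq_2; smt (z3)\<close>)+
qed

section \<open>Deficit 0 under both constraints, by explicit cuts\<close>

lemma regionI:
  assumes "1 \<le> m" "m + int t \<le> n + 1" "25 * n \<le> 38 * m + bound t d"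
  shows "region t d m n"
  using assms by (simp add: region_def)

lemma splitsI:
  assumes "region (of_bool L + of_bool e) d1 k (l + of_bool e)"
    "region (of_bool e + of_bool R) d2 (m - k) (n - l)"
    and "0 \<le> l" "l + of_bool e \<le> n" "d1 \<le> 2" "d2 \<le> 2" "d1 + d2 \<le> d + of_bool e"
  shows "splits L R d m n k l e d1 d2"
  using assms by (simp add: splits_def)

lemma crossing_vertexI:
  assumes "splits L R d m n (i + 1) l False d1 d2" "splits L R d m n i l e d3 d4"
  shows "\<exists>l. crossing L R d m n i l"
proof -
  have "0 \<le> l" "l \<le> n" using assms(1) by (simp_all add: splits_def)
  moreover have "splits L R d m n (i + 1) (l - of_bool False) False d1 d2" using assms(1) by simp
  ultimately show ?thesis using assms(2) unfolding crossing_def by blast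
qed

text \<open>The cut after row \<open>i\<close> shares the element at index \<open>l - 1\<close>, so
  its first part still ends at height \<open>l\<close>.\<close>

lemma crossing_edgeI:
  assumes "splits L R d m n (i + 1) (l - 1) True d1 d2" "splits L R d m n i l e d3 d4"
  shows "\<exists>l. crossing L R d m n i l"
proof -
  have "0 \<le> l" "l \<le> n" using assms by (simp_all add: splits_def)
  moreover have "splits L R d m n (i + 1) (l - of_bool True) True d1 d2" using assms(1) by simp
  ultimately show ?thesis using assms(2) unfolding crossing_def by blast
qed

lemma crossing_TT_0:
  assumes "extreme 2 0 m n" "0 \<le> i" "i < m"
  shows "\<exists>l. crossing True True 0 m n i l"
proof -
  have r: "1 \<le> n" "m + 1 \<le> n" "25 * n \<le> 38 * m - 16" and e: "1 < m" "38 * m - 29 < 25 * n"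
    using assms by (auto simp: extreme_def region_def bound_def)
  consider "i = 0" | "i + 1 = m" | "1 \<le> i" "i + 2 \<le> m" using assms by linarith
  then show ?thesis
  proof cases
    case 1
    have "splits True True 0 m n (i + 1) 1 False 0 0" "splits True True 0 m n i 1 False 0 0"
      using 1 r e by (auto intro!: splitsI simp: region_def bound_def)
    then show ?thesis by (rule crossing_vertexI)
  next
    case 2
    have "splits True True 0 m n (i + 1) (n - 1) False 0 0" "splits True True 0 m n i (n - 1) False 0 0"
      using 2 r e by (auto intro!: splitsI simp: region_def bound_def)
    then show ?thesis by (rule crossing_vertexI)
  next
    case 3
    \<comment> \<open>The least height at which the second part of an unshared cut after row
      \<open>i\<close> satisfies the bound 17.\<close>
    obtain l where l: "38 * (i + 1) + 25 * n - 38 * m - 17 \<le> 25 * l"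
        "25 * l < 38 * (i + 1) + 25 * n - 38 * m - 17 + 25" by (rule multiple_above)
    \<comment> \<open>The first inequality is the bound 17 for the part before row \<open>i\<close>.
      If it fails, height \<open>l - 1\<close> with a shared cut is tried;
      \<open>i + 3 \<le> l\<close> gives its doubly constrained first part of \<open>i + 1\<close>
      rows enough \<open>B\<close>s.\<close>
    consider (vertex) "25 * l \<le> 38 * (i + 1) - 21"
      | (right) "38 * (i + 1) - 21 < 25 * l" "i + 3 \<le> l"
      | (left) "38 * (i + 1) - 21 < 25 * l" "l < i + 3" by linarith
    then show ?thesis
    proof cases
      case vertex
      have "splits True True 0 m n (i + 1) l False 0 0" "splits True True 0 m n i l False 0 0"
        using 3 r e l vertex by ((intro splitsI regionI; (simp add: bound_def)?; linarith)+)
      then show ?thesis by (rule crossing_vertexI)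
    next
      case right
      have "splits True True 0 m n (i + 1) (l - 1 - 1) True 0 1" "splits True True 0 m n i (l - 1) False 0 0"
        using 3 r e l right by ((intro splitsI regionI; (simp add: bound_def)?; linarith)+)
      then show ?thesis by (rule crossing_edgeI)
    next
      case left
      \<comment> \<open>Only \<open>i = 2\<close>, \<open>l = 4\<close> survives; there the cut
        before row \<open>i\<close> shares a \<open>B\<close> instead.\<close>
      have "i \<noteq> 1"
      proof
        assume "i = 1"
        then have "3 \<le> l" using left by simp
        then show False using \<open>i = 1\<close> l r by simp
      qed
      moreover have "i \<le> 2" using left by (smt (z3))
      ultimately have i: "i = 2" using 3 by linarith
      then have il: "i = 2" "l = 4" using left by simp_all
      then have E: "25 * n - 38 * m \<ge> - 21" using l by simp
      \<comment> \<open>No multiple of 13 lies in the resulting ranges. The doubly constrained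
        second part of \<open>m - 2\<close> rows and \<open>n - 4\<close> columns needs
        \<open>m + 3 \<le> n\<close>.\<close>
      have "n \<noteq> m + 1"
      proof
        assume "n = m + 1"
        then have "41 \<le> 13 * m" "13 * m \<le> 46" using r E by simp_all
        then show False by presburger
      qed
      moreover have "n \<noteq> m + 2"
      proof
        assume "n = m + 2"
        then have "66 \<le> 13 * m" "13 * m \<le> 71" using r E by simp_all
        then show False by presburger
      qed
      ultimately have "m + 3 \<le> n" using r by linarith
      then have "splits True True 0 m n (i + 1) l False 0 0" "splits True True 0 m n i l True 1 0"
        using 3 il r E by ((intro splitsI regionI; (simp add: bound_def)?; linarith)+)
      then show ?thesis by (rule crossing_vertexI)
    qed
  qed
qed

lemma crossing_exists:
  assumes "L \<longrightarrow> R" "d \<le> 2" "extreme (of_bool L + of_bool R) d m n" "0 \<le> i" "i < m"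
  shows "\<exists>l. crossing L R d m n i l"
proof -
  consider "d = 0" | "d = 1" | "d = 2" using assms(2) by linarith
  then show ?thesis
  proof cases
    case 1
    then show ?thesis
      using assms crossing_FF_0[of m n i] crossing_FT_0[of m n i] crossing_TT_0[of m n i]
      by (cases L; cases R; simp add: numeral_2_eq_2)
  next
    case 2
    then show ?thesis
      using assms crossing_FF_1[of m n i] crossing_FT_1[of m n i] crossing_TT_1[of m n i]
      by (cases L; cases R; simp add: numeral_2_eq_2)
  next
    case 3
    then show ?thesis
      using assms crossing_FF_2[of m n i] crossing_FT_2[of m n i] crossing_TT_2[of m n i]
      by (cases L; cases R; simp add: numeral_2_eq_2)
  qed
qed

text \<open>Sizes that are not extreme reduce to \<open>(m - 1, n - 1)\<close> by
  \<open>forces_Suc_Suc\<close>; extreme ones are cut at a crossing height into smaller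
  blocks.\<close>

lemma forces_region:
  assumes "region (of_bool L + of_bool R) d (int m) (int n)" "d \<le> 2"
  shows "forces L R m n d"
  using assms
proof (induction "m + n" arbitrary: L R m n d rule: less_induct)
  case less
  define t :: nat where "t = of_bool L + of_bool R"
  have reg: "region t d (int m) (int n)" using less.prems(1) by (simp add: t_def)
  consider "m = 0" | "0 < m" "n = 0" | "m = 1" "n = 1"
    | "0 < m" "0 < n" "region t d (int m - 1) (int n - 1)" | "extreme t d (int m) (int n)"
    using reg unfolding extreme_def by force
  then show ?case
  proof cases
    case 1
    then show ?thesis using reg by (auto simp: region_def intro: forces_B)
  next
    case 2
    then have "m = 1" "\<not> L" "\<not> R" using reg by (cases L; cases R; auto simp: region_def t_def)+
    then show ?thesis using 2 by (auto intro: forces_A)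
  next
    case 3
    then have "\<not> L \<or> \<not> R" using reg by (auto simp: region_def t_def)
    then show ?thesis
      using 3 forces_one_A[of 1 0 L] forces_one_B[of 1 0 R] by (auto intro: forces_mono[of _ _ _ _ 0])
  next
    case 4
    then have "forces L R (m - 1) (n - 1) d"
      using less.prems(2) by (intro less.hyps) (auto simp: t_def of_nat_diff)
    then show ?thesis using forces_Suc_Suc[of L R "m - 1" "n - 1" d] 4 by simp
  next
    case ext: 5
    \<comment> \<open>The bounds depend only on the number of constraints, so a single constraint
      may be taken as \<open>R\<close>; reversal covers \<open>L\<close>.\<close>
    have main: "forces L R m n d" if LR: "t = of_bool L + of_bool R" "L \<longrightarrow> R" for L R
    proof (rule cut)
      show "0 < m" "0 < n" using ext by (auto simp: extreme_def)
      fix i j assume ij: "i < m" "j < n"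
      obtain l' where l': "crossing L R d (int m) (int n) (int i) l'"
        using crossing_exists[of L R d "int m" "int n" "int i"] ext LR less.prems(2) ij by auto
      then obtain l where "l' = int l" by (metis crossing_def zero_le_imp_eq_int)
      with l' have l: "crossing L R d (int m) (int n) (int i) (int l)" by simp
      have sub: "forces L' R' k r d'"
        if "region (of_bool L' + of_bool R') d' (int k) (int r)" "d' \<le> 2" "k + r < m + n" for L' R' k r d'
        using less.hyps that by blast
      show "\<exists>k l k' l' e d1 d2. m = k + k' \<and> n = l + l' \<and>
         (i < k \<and> l + of_bool e \<le> j \<or> k \<le> i \<and> j < l) \<and>
         forces L e k (l + of_bool e) d1 \<and> forces e R k' l' d2 \<and> d1 + d2 \<le> d + of_bool e"
      proof (cases "j < l")
        case True
        then obtain e d1 d2 where s: "splits L R d (int m) (int n) (int i) (int l) e d1 d2"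
          using l unfolding crossing_def by auto
        then have le: "l + of_bool e \<le> n" by (auto simp: splits_def)
        have "forces L e i (l + of_bool e) d1"
          using s ij le by (intro sub) (auto simp: splits_def)
        moreover have "forces e R (m - i) (n - l) d2"
          using s ij le True by (intro sub) (auto simp: splits_def of_nat_diff)
        ultimately show ?thesis
          using s ij le True by - (rule cutI[of m i "m - i" n l "n - l" i e j L d1 R d2 d]; auto simp: splits_def)
      next
        case False
        then obtain e d1 d2 where s: "splits L R d (int m) (int n) (int i + 1) (int l - of_bool e) e d1 d2"
          using l ij unfolding crossing_def by auto
        then have le: "of_bool e \<le> l" by (cases e) (auto simp: splits_def)
        then have il: "int l - of_bool e = int (l - of_bool e)" by (simp add: of_nat_diff)
        have "forces L e (Suc i) l d1"
          using s ij False by (intro sub) (auto simp: splits_def algebra_simps)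
        then have "forces L e (Suc i) (l - of_bool e + of_bool e) d1" using le by simp
        moreover have "forces e R (m - Suc i) (n - (l - of_bool e)) d2"
        proof (rule sub)
          show "region (of_bool e + of_bool R) d2 (int (m - Suc i)) (int (n - (l - of_bool e)))"
            using s ij False le by (auto simp: splits_def of_nat_diff algebra_simps)
          show "d2 \<le> 2" using s by (auto simp: splits_def)
          show "m - Suc i + (n - (l - of_bool e)) < m + n" using ij by auto
        qed
        ultimately show ?thesis
          using s ij le False
          by - (rule cutI[of m "Suc i" "m - Suc i" n "l - of_bool e" "n - (l - of_bool e)" i e j L d1 R d2 d]; auto simp: splits_def)
      qed
    qed
    show ?thesis
    proof (cases "L \<longrightarrow> R")
      case True
      then show ?thesis by (intro main) (simp_all add: t_def)
    next
      case False
      then have "forces R L m n d" by (intro main) (simp_all add: t_def)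
      then show ?thesis by (rule forces_reverse)
    qed
  qed
qed

section \<open>Interleavings and decision trees\<close>

text \<open>This keeps the interval of admissible values nonempty. With a single \<open>B\<close>
  under both constraints, either answer to its comparison with the first \<open>A\<close> would
  leave a constrained part without a \<open>B\<close>.\<close>

lemma forces_room:
  assumes "forces L R m n d" "0 < m"
  shows "of_bool L + of_bool R \<le> n"
  using assms(1)
proof cases
  case one_sided
  then show ?thesis using assms(2) by auto
next
  case cut
  show ?thesis
  proof (cases "L \<and> R \<and> n = 1")
    case True
    from cut(3)[OF cut(1,2)] obtain k l k' l' e d1 d2 where c: "n = l + l'"
      "0 < k \<and> l + of_bool e \<le> 0 \<or> k \<le> 0 \<and> 0 < l"
      "forces L e k (l + of_bool e) d1" "forces e R k' l' d2"
      by blast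
    show ?thesis using True c forces_constraint[OF c(3)] forces_constraint[OF c(4)] by auto
  next
    case False
    then show ?thesis using cut(2) by auto
  qed
qed

text \<open>The summand \<open>nudge i\<close> only breaks ties; it increases with \<open>i\<close> and lies strictly between 0 and 1.\<close>

definition nudge :: "nat \<Rightarrow> real" where
  "nudge i = real (i + 1) / real (i + 2)"

lemma nudge_bounds: "0 < nudge i" "nudge i < 1"
  by (simp_all add: nudge_def)

lemma nudge_strict_mono: "i < j \<Longrightarrow> nudge i < nudge j"
  by (simp add: nudge_def field_simps)

text \<open>\<open>A i\<close> lies strictly between the integers \<open>h i\<close> and
  \<open>h i + 1\<close>, hence above exactly the first \<open>h i\<close> of the \<open>B\<close>s,
  which sit at 1, 2, and so on.\<close>

definition interleaving :: "(nat \<Rightarrow> nat) \<Rightarrow> elem \<Rightarrow> real" where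
  "interleaving h x = (case x of A i \<Rightarrow> real (h i) + nudge i | B j \<Rightarrow> real (j + 1))"

lemma interleaving_AB [simp]: "interleaving h (A i) < interleaving h (B j) \<longleftrightarrow> h i \<le> j"
proof (cases "h i \<le> j")
  case True
  then have "real (h i) \<le> real j" by simp
  then show ?thesis using True nudge_bounds[of i] by (simp add: interleaving_def)
next
  case False
  then have "real (h i) \<ge> real (j + 1)" by linarith
  then show ?thesis using False nudge_bounds[of i] by (simp add: interleaving_def)
qed

lemma interleaving_BA [simp]: "interleaving h (B j) < interleaving h (A i) \<longleftrightarrow> j < h i"
proof (cases "h i \<le> j")
  case True
  then have "real (h i) \<le> real j" by simp
  then show ?thesis using True nudge_bounds[of i] by (simp add: interleaving_def)
next
  case False
  then have "real (h i) \<ge> real (j + 1)" by linarith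
  then show ?thesis using False nudge_bounds[of i] by (simp add: interleaving_def)
qed

lemma interleaving_BB [simp]: "interleaving h (B i) < interleaving h (B j) \<longleftrightarrow> i < j"
  by (simp add: interleaving_def)

lemma interleaving_A_less:
  assumes "mono_on {..<m} h" "i < j" "j < m"
  shows "interleaving h (A i) < interleaving h (A j)"
proof -
  have "h i \<le> h j" using assms by (intro mono_onD[OF assms(1)]) auto
  then show ?thesis using nudge_strict_mono[OF assms(2)] by (simp add: interleaving_def add_le_less_mono)
qed

lemma interleaving_AA:
  assumes "mono_on {..<m} h" "i < m" "j < m"
  shows "interleaving h (A i) < interleaving h (A j) \<longleftrightarrow> i < j"
  using interleaving_A_less[OF assms(1)] assms(2,3) by (metis less_asym less_irrefl linorder_neqE_nat)

lemma interleaving_input: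
  assumes "mono_on {..<m} h"
  shows "interleaving h \<in> inputs m n"
proof -
  have "interleaving h x \<noteq> interleaving h y" if "x \<in> elems m n" "y \<in> elems m n" "x \<noteq> y" for x y
  proof -
    have "interleaving h x < interleaving h y \<or> interleaving h y < interleaving h x"
      using that interleaving_AA[OF assms] by (cases x; cases y) (auto simp: elems_def)
    then show ?thesis by auto
  qed
  then show ?thesis
    using assms by (auto simp: inputs_def inj_on_def intro!: strict_mono_onI interleaving_A_less) 
qed

section \<open>Comparisons that cannot be avoided\<close>

primrec asks :: "algorithm \<Rightarrow> (elem \<Rightarrow> real) \<Rightarrow> elem \<Rightarrow> elem \<Rightarrow> bool" where
  "asks (Output xs) v a b \<longleftrightarrow> False"
| "asks (Compare x y l r) v a b \<longleftrightarrow> {x, y} = {a, b} \<or> (if v x < v y then asks l v a b else asks r v a b)"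

lemma result_cong:
  assumes "\<And>x y. x \<in> X \<Longrightarrow> y \<in> X \<Longrightarrow> {x, y} \<noteq> {a, b} \<Longrightarrow> v x < v y \<longleftrightarrow> v' x < v' y"
    and "queries t \<subseteq> X" "\<not> asks t v a b"
  shows "result t v = result t v'"
  using assms(2,3)
proof (induction t)
  case (Compare x y l r)
  then have "v x < v y \<longleftrightarrow> v' x < v' y" by (intro assms(1)) auto
  then show ?case using Compare by auto
qed simp

text \<open>\<open>A i\<close> and \<open>B j\<close> are neighbours in the order given by \<open>h\<close>, so that exchanging them yields another
  interleaving.\<close>

definition flippable :: "nat \<Rightarrow> (nat \<Rightarrow> nat) \<Rightarrow> nat \<Rightarrow> nat \<Rightarrow> bool" where
  "flippable m h i j \<longleftrightarrow> (h i = j \<or> h i = Suc j) \<and>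
     mono_on {..<m} (h(i := j)) \<and> mono_on {..<m} (h(i := Suc j))"

text \<open>Otherwise the run and its output would be the same for both orders of the neighbours
  \<open>A i\<close> and \<open>B j\<close>, but only one of them matches the output.\<close>

lemma must_ask:
  assumes t: "merging_algorithm m n t" and f: "flippable m h i j" and ij: "i < m" "j < n"
  shows "asks t (interleaving h) (A i) (B j)"
proof (rule ccontr)
  assume not_asked: "\<not> asks t (interleaving h) (A i) (B j)"
  let ?u = "interleaving (h(i := j))" and ?w = "interleaving (h(i := Suc j))"
  have mono: "mono_on {..<m} h" using f unfolding flippable_def by (metis fun_upd_triv)
  have same: "result t (interleaving h) = result t (interleaving (h(i := k)))" if k: "k = j \<or> k = Suc j" for k
  proof (rule result_cong[where X = "elems m n"])
    have mono_k: "mono_on {..<m} (h(i := k))" using f k by (auto simp: flippable_def)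
    fix x y assume "x \<in> elems m n" "y \<in> elems m n" "{x, y} \<noteq> {A i, B j}"
    then show "interleaving h x < interleaving h y \<longleftrightarrow> interleaving (h(i := k)) x < interleaving (h(i := k)) y"
      using k f interleaving_AA[OF mono] interleaving_AA[OF mono_k]
      by (cases x; cases y) (auto simp: elems_def flippable_def)
  next
    show "queries t \<subseteq> elems m n" using t by (simp add: merging_algorithm_def)
  qed (rule not_asked)
  define xs where "xs = result t ?u"
  have "sorted_wrt (\<lambda>x y. ?u x < ?u y) xs" "set xs = elems m n"
    using t f interleaving_input unfolding merging_algorithm_def flippable_def xs_def by blast+
  moreover have "xs = result t ?w" unfolding xs_def using same[of j] same[of "Suc j"] by simp
  then have "sorted_wrt (\<lambda>x y. ?w x < ?w y) xs"
    using t f interleaving_input unfolding merging_algorithm_def flippable_def by blast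
  moreover have "A i \<in> elems m n" "B j \<in> elems m n" using ij by (auto simp: elems_def)
  ultimately obtain p q where pq: "p < length xs" "q < length xs" "xs ! p = A i" "xs ! q = B j"
    by (metis in_set_conv_nth)
  then consider "p < q" | "q < p" by (metis elem.distinct(1) linorder_neqE_nat)
  then show False
  proof cases
    case 1
    then have "?w (A i) < ?w (B j)"
      using \<open>sorted_wrt (\<lambda>x y. ?w x < ?w y) xs\<close> pq by (metis sorted_wrt_nth_less)
    then show False by simp
  next
    case 2
    then have "?u (B j) < ?u (A i)"
      using \<open>sorted_wrt (\<lambda>x y. ?u x < ?u y) xs\<close> pq by (metis sorted_wrt_nth_less)
    then show False by simp
  qed
qed

section \<open>The adversary\<close>

text \<open>The block \<open>(a, m, b, n, L, R, d)\<close> consists of \<open>A a, \<dots>, A (a + m - 1)\<close> and \<open>B b, \<dots>, B (b + n - 1)\<close>.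
  In terms of \<open>h\<close>, the constraints \<open>L\<close> and \<open>R\<close> just shrink the interval \<open>[b, b + n]\<close> of admissible values.\<close>

type_synonym block = "nat \<times> nat \<times> nat \<times> nat \<times> bool \<times> bool \<times> nat"

fun row :: "block \<Rightarrow> nat \<Rightarrow> bool" where
  "row (a, m, b, n, L, R, d) i \<longleftrightarrow> a \<le> i \<and> i < a + m"

fun cell :: "block \<Rightarrow> nat \<Rightarrow> nat \<Rightarrow> bool" where
  "cell (a, m, b, n, L, R, d) i j \<longleftrightarrow> a \<le> i \<and> i < a + m \<and> b \<le> j \<and> j < b + n"

fun fits :: "(nat \<Rightarrow> nat) \<Rightarrow> block \<Rightarrow> bool" where
  "fits h (a, m, b, n, L, R, d) \<longleftrightarrow>
     (\<forall>i. a \<le> i \<and> i < a + m \<longrightarrow> b + of_bool L \<le> h i \<and> h i + of_bool R \<le> b + n)"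

fun gain :: "block \<Rightarrow> nat" where
  "gain (a, m, b, n, L, R, d) = m + n - 1 - d"

fun legal :: "nat \<Rightarrow> nat \<Rightarrow> block \<Rightarrow> bool" where
  "legal u w (a, m, b, n, L, R, d) \<longleftrightarrow> forces L R m n d \<and> a + m \<le> u \<and> b + n \<le> w"

text \<open>The two bounds on \<open>b + n\<close> let blocks overlap in one \<open>B\<close>, and
  only if both are committed to it.\<close>

fun precedes :: "block \<Rightarrow> block \<Rightarrow> bool" where
  "precedes (a, m, b, n, L, R, d) (a', m', b', n', L', R', d') \<longleftrightarrow>
     a + m \<le> a' \<and> b + n \<le> b' + of_bool L' \<and> b + n \<le> b' + of_bool R"

definition position :: "nat \<Rightarrow> nat \<Rightarrow> block list \<Rightarrow> bool" where
  "position u w zs \<longleftrightarrow> (\<forall>z\<in>set zs. legal u w z) \<and> sorted_wrt precedes zs \<and>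
     (\<forall>i<u. \<exists>z\<in>set zs. row z i)"

definition choices :: "nat \<Rightarrow> block list \<Rightarrow> (nat \<Rightarrow> nat) set" where
  "choices u zs = {h. mono_on {..<u} h \<and> (\<forall>z\<in>set zs. fits h z)}"

lemma legal_room:
  assumes "legal u w (a, m, b, n, L, R, d)" "row (a, m, b, n, L, R, d) i"
  shows "of_bool L + of_bool R \<le> n"
  using assms by (intro forces_room[of L R m n d]) auto

lemma precedes_row: "precedes z z' \<Longrightarrow> row z i \<Longrightarrow> row z' i' \<Longrightarrow> i < i'"
  by (cases z; cases z') auto

lemma position_row_unique:
  assumes "position u w (xs @ z # ys)" "row z i" "z' \<in> set xs \<union> set ys"
  shows "\<not> row z' i"
  using assms precedes_row[of z z' i i] precedes_row[of z' z i i]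
  by (auto simp: position_def sorted_wrt_append)

text \<open>Every row takes the least value its block admits, which leaves a flippable pair in each
  block of positive gain.\<close>

lemma choice_exists:
  assumes pos: "position u w zs"
  obtains h where "h \<in> choices u zs"
    "\<And>z. z \<in> set zs \<Longrightarrow> gain z = 0 \<or> (\<exists>i j. cell z i j \<and> flippable u h i j)"
proof -
  define low :: "block \<Rightarrow> nat" where "low = (\<lambda>(a, m, b, n, L, R, d). b + of_bool L)"
  define h where "h i = (if i < u then low (SOME z. z \<in> set zs \<and> row z i) else 0)" for i
  have ord: "precedes z z' \<or> precedes z' z \<or> z = z'" if "z \<in> set zs" "z' \<in> set zs" for z z'
    using pos that unfolding position_def by (metis in_set_conv_nth linorder_neqE_nat sorted_wrt_nth_less)
  have h: "h i = low z" if z: "z \<in> set zs" "row z i" for z i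
  proof -
    have "i < u" using pos z by (cases z) (force simp: position_def)
    moreover have "(SOME z. z \<in> set zs \<and> row z i) = z"
    proof (rule some_equality)
      fix z' assume "z' \<in> set zs \<and> row z' i"
      then show "z' = z" using ord[of z z'] z precedes_row by blast
    qed (use z in simp)
    ultimately show ?thesis by (simp add: h_def)
  qed
  have legal: "legal u w z" if "z \<in> set zs" for z using pos that by (simp add: position_def)
  have mono: "mono_on {..<u} h"
  proof (rule mono_onI)
    fix i i' assume i: "i \<in> {..<u}" "i' \<in> {..<u}" "i \<le> i'"
    then obtain z z' where z: "z \<in> set zs" "row z i" "z' \<in> set zs" "row z' i'"
      using pos unfolding position_def by blast
    consider "z = z'" | "precedes z z'" using ord[OF z(1,3)] precedes_row[of z' z i' i] z i by force
    then show "h i \<le> h i'"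
    proof cases
      case 1
      then show ?thesis using h z by simp
    next
      case 2
      have "low z \<le> low z'"
      proof (cases z, cases z')
        fix a m b n L R d a' m' b' n' L' R' d'
        assume zz: "z = (a, m, b, n, L, R, d)" "z' = (a', m', b', n', L', R', d')"
        then have "of_bool L + of_bool R \<le> n"
          using legal_room legal[OF z(1)] z(2) by blast
        then show ?thesis using 2 zz by (auto simp: low_def)
      qed
      then show ?thesis using h z by simp
    qed
  qed
  have fits: "fits h z" if "z \<in> set zs" for z
  proof (cases z)
    case (fields a m b n L R d)
    have "h i = b + of_bool L" if "a \<le> i" "i < a + m" for i
      using h[OF \<open>z \<in> set zs\<close>, of i] fields that by (simp add: low_def)
    moreover have "of_bool L + of_bool R \<le> n" if "0 < m"
      using legal[OF \<open>z \<in> set zs\<close>] that fields by (intro legal_room[of u w a m b n L R d a]) auto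
    ultimately show ?thesis using fields by (auto simp: add.commute)
  qed
  show thesis
  proof
    show "h \<in> choices u zs" using mono fits by (simp add: choices_def)
    fix z assume z: "z \<in> set zs"
    show "gain z = 0 \<or> (\<exists>i j. cell z i j \<and> flippable u h i j)"
    proof (cases z)
      case (fields a m b n L R d)
      show ?thesis
      proof (cases "gain z = 0")
        case False
        have f: "forces L R m n d" "a + m \<le> u" using legal[OF z] fields by auto
        then have mn: "0 < m" "0 < n" using False fields by (auto elim!: forces.cases)
        have hz: "h i = b + of_bool L" if "a \<le> i" "i < a + m" for i
          using h[OF z, of i] fields that by (simp add: low_def)
        have before: "h i \<le> b" if i: "i < a" for i
        proof -
          have "i < u" using i f(2) mn by linarith
          then obtain z' where z': "z' \<in> set zs" "row z' i"
            using pos unfolding position_def by blast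
          have "precedes z' z"
            using ord[OF z z'(1)] precedes_row[of z z' a i] z' i mn fields by force
          moreover obtain a' m' b' n' L' R' d' where zz: "z' = (a', m', b', n', L', R', d')"
            by (cases z')
          moreover have "of_bool L' + of_bool R' \<le> n'"
            using legal_room legal[OF z'(1)] z'(2) zz by blast
          ultimately show ?thesis using h[OF z'] fields by (simp add: low_def)
        qed
        have after: "b + n \<le> h i" if i: "a + m \<le> i" "i < u" for i
        proof -
          obtain z' where z': "z' \<in> set zs" "row z' i" using pos i unfolding position_def by blast
          have "precedes z z'"
            using ord[OF z z'(1)] precedes_row[of z' z i a] z' i mn fields by force
          then show ?thesis using h[OF z'] fields by (cases z') (simp add: low_def)
        qed
        \<comment> \<open>Under \<open>L\<close> all rows of the block have value
          \<open>b + 1\<close> and the first can drop to \<open>b\<close>; otherwise all have value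
          \<open>b\<close> and the last can rise to \<open>b + 1\<close>.\<close>
        define i where "i = (if L then a else a + m - 1)"
        have "mono_on {..<u} (h(i := x))" if x: "b \<le> x" "x \<le> Suc b" for x
        proof (rule mono_onI)
          fix p q assume pq: "p \<in> {..<u}" "q \<in> {..<u}" "p \<le> q"
          have "h p \<le> h q" using pq by (intro mono_onD[OF mono]) auto
          moreover have "Suc b \<le> h q" if "p = i" "q \<noteq> i"
          proof (cases "a + m \<le> q")
            case True
            then show ?thesis using after[of q] pq mn by simp
          next
            case False
            then show ?thesis using hz[of q] that pq by (auto simp: i_def split: if_splits)
          qed
          moreover have "h p \<le> b" if "q = i" "p \<noteq> i"
          proof (cases "p < a")
            case True
            then show ?thesis by (rule before)
          next
            case False
            then show ?thesis using hz[of p] that pq mn by (auto simp: i_def split: if_splits)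
          qed
          ultimately show "(h(i := x)) p \<le> (h(i := x)) q" using x by (cases "p = i"; cases "q = i") auto
        qed
        then have "mono_on {..<u} (h(i := b))" "mono_on {..<u} (h(i := Suc b))" by simp_all
        moreover have "h i = b \<or> h i = Suc b" "cell z i b"
          using hz[of i] mn fields by (auto simp: i_def)
        ultimately show ?thesis unfolding flippable_def by blast
      qed simp
    qed
  qed
qed

text \<open>One answer of the adversary, given by the cut that \<open>forces\<close> supplies. The
  summand 1 in the bound on \<open>gain z\<close> is the comparison being answered.\<close>

lemma refine_position:
  assumes pos: "position u w (xs @ z # ys)" and ij: "cell z i j"
  obtains z1 z2 c where "position u w (xs @ z1 # z2 # ys)"
    "choices u (xs @ z1 # z2 # ys) \<subseteq> choices u (xs @ z # ys)"
    "\<And>h. h \<in> choices u (xs @ z1 # z2 # ys) \<Longrightarrow> (h i \<le> j) = c"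
    "gain z \<le> gain z1 + gain z2 + 1"
    "\<And>p q. cell z1 p q \<or> cell z2 p q \<Longrightarrow> cell z p q \<and> (p, q) \<noteq> (i, j)"
proof (cases z)
  case z: (fields a m b n L R d)
  have f: "forces L R m n d" "a + m \<le> u" "b + n \<le> w"
    and ij': "a \<le> i" "i < a + m" "b \<le> j" "j < b + n"
    using pos ij z by (auto simp: position_def)
  then have "\<exists>k l k' l' e d1 d2. m = k + k' \<and> n = l + l' \<and>
      (i - a < k \<and> l + of_bool e \<le> j - b \<or> k \<le> i - a \<and> j - b < l) \<and>
      forces L e k (l + of_bool e) d1 \<and> forces e R k' l' d2 \<and> d1 + d2 \<le> d + of_bool e"
    by (cases rule: forces.cases) auto
  then obtain k l k' l' e d1 d2 where c: "m = k + k'" "n = l + l'"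
      "i - a < k \<and> l + of_bool e \<le> j - b \<or> k \<le> i - a \<and> j - b < l"
      "forces L e k (l + of_bool e) d1" "forces e R k' l' d2" "d1 + d2 \<le> d + of_bool e"
    by blast
  have e: "of_bool e \<le> l'" "R \<Longrightarrow> 0 < l'" "L \<Longrightarrow> 0 < l + of_bool e"
    using forces_constraint[OF c(4)] forces_constraint[OF c(5)] by (cases e; auto)+
  define z1 where "z1 = (a, k, b, l + of_bool e, L, e, d1)"
  define z2 where "z2 = (a + k, k', b + l, l', e, R, d2)"
  have legal: "legal u w z1" "legal u w z2" using c f e by (auto simp: z1_def z2_def)
  have "precedes z1 z2" by (simp add: z1_def z2_def)
  moreover have "precedes z' z1 \<and> precedes z' z2" if "precedes z' z" for z'
  proof (cases z')
    case (fields a' m' b' n' L' R' d')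
    have "of_bool L \<le> l + of_bool e" using e(3) by (cases L) auto
    then show ?thesis using that by (auto simp: fields z z1_def z2_def)
  qed
  moreover have "precedes z1 z' \<and> precedes z2 z'" if "precedes z z'" for z'
  proof (cases z')
    case (fields a' m' b' n' L' R' d')
    have "of_bool R \<le> l'" using e(2) by (cases R) auto
    then show ?thesis using that e(1) c(1,2) by (auto simp: fields z z1_def z2_def)
  qed
  moreover have rows: "row z p \<longleftrightarrow> row z1 p \<or> row z2 p" for p
    using c by (auto simp: z z1_def z2_def)
  ultimately have pos': "position u w (xs @ z1 # z2 # ys)"
    using pos legal unfolding position_def by (auto simp: sorted_wrt_append)
  have fits: "fits h z" if "fits h z1" "fits h z2" for h
  proof -
    have "b + of_bool L \<le> h p \<and> h p + of_bool R \<le> b + n" if "a \<le> p" "p < a + m" for p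
    proof (cases "p < a + k")
      case True
      then have "b + of_bool L \<le> h p" "h p \<le> b + l"
        using \<open>fits h z1\<close> that by (auto simp: z1_def)
      then show ?thesis using e c(2) by (cases R) auto
    next
      case False
      moreover have "\<forall>q. a + k \<le> q \<and> q < a + k + k' \<longrightarrow>
          b + l + of_bool e \<le> h q \<and> h q + of_bool R \<le> b + l + l'"
        using \<open>fits h z2\<close> by (simp add: z2_def)
      ultimately have "b + l + of_bool e \<le> h p" "h p + of_bool R \<le> b + n"
        using that c(1,2) by (auto dest!: spec[of _ p])
      then show ?thesis using e by (cases L) auto
    qed
    then show ?thesis by (simp add: z)
  qed
  show thesis
  proof
    show "position u w (xs @ z1 # z2 # ys)" by (rule pos')
    show "choices u (xs @ z1 # z2 # ys) \<subseteq> choices u (xs @ z # ys)"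
      using fits by (auto simp: choices_def)
    show "gain z \<le> gain z1 + gain z2 + 1"
      using c(1,2,6) by (cases e) (auto simp: z z1_def z2_def)
    show "cell z p q \<and> (p, q) \<noteq> (i, j)" if "cell z1 p q \<or> cell z2 p q" for p q
      using that c(1-3) e ij' by (auto simp: z z1_def z2_def)
    show "(h i \<le> j) = (i < a + k)" if "h \<in> choices u (xs @ z1 # z2 # ys)" for h
    proof -
      have "fits h z1" "fits h z2" using that by (auto simp: choices_def)
      show ?thesis
      proof (cases "i < a + k")
        case True
        then have "h i \<le> b + l" using \<open>fits h z1\<close> ij' by (auto simp: z1_def)
        then show ?thesis using c(3) True ij' by auto
      next
        case False
        then have "b + l \<le> h i"
          using \<open>fits h z2\<close> ij' c(1,2) by (auto simp: z2_def dest!: spec[of _ i])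
        then show ?thesis using c(3) False ij' by auto
      qed
    qed
  qed
qed

text \<open>The block of \<open>A i\<close> confines \<open>h i\<close> to
  \<open>[b, b + n]\<close>, and a \<open>B j\<close> outside the block lies on one side of this
  whole interval.\<close>

lemma answer_fixed:
  assumes pos: "position u w zs" and xy: "x \<in> elems u w" "y \<in> elems u w"
    and no_cell: "\<And>i j z. {x, y} = {A i, B j} \<Longrightarrow> z \<in> set zs \<Longrightarrow> \<not> cell z i j"
  obtains c where "\<And>h. h \<in> choices u zs \<Longrightarrow> (interleaving h x < interleaving h y) = c"
proof -
  have fixed: "\<exists>c. \<forall>h\<in>choices u zs. (h i \<le> j) = c" if ij: "i < u" "{x, y} = {A i, B j}" for i j
  proof -
    obtain z' where z': "z' \<in> set zs" "row z' i" using pos ij(1) unfolding position_def by blast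
    obtain a m b n L R d where "z' = (a, m, b, n, L, R, d)" by (cases z')
    with z' have z: "(a, m, b, n, L, R, d) \<in> set zs" "a \<le> i" "i < a + m" by simp_all
    have "(h i \<le> j) = (b + n \<le> j)" if "h \<in> choices u zs" for h
    proof -
      have "b \<le> h i \<and> h i \<le> b + n" using that z by (fastforce simp: choices_def)
      moreover have "j < b \<or> b + n \<le> j" using no_cell[OF ij(2) z(1)] z by auto
      ultimately show ?thesis by auto
    qed
    then show ?thesis by blast
  qed
  show thesis
  proof (cases x; cases y)
    fix i j assume "x = A i" "y = B j"
    moreover then obtain c where "\<forall>h\<in>choices u zs. (h i \<le> j) = c"
      using fixed[of i j] xy by (auto simp: elems_def)
    ultimately show thesis by (intro that[of c]) simp
  next
    fix i j assume "x = B j" "y = A i"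
    moreover then obtain c where "\<forall>h\<in>choices u zs. (h i \<le> j) = c"
      using fixed[of i j] xy by (auto simp: elems_def insert_commute)
    ultimately show thesis by (intro that[of "\<not> c"]) auto
  next
    fix i j assume "x = A i" "y = A j"
    then show thesis
      using xy by (intro that[of "i < j"]) (auto simp: elems_def choices_def interleaving_AA)
  next
    fix i j assume "x = B i" "y = B j"
    then show thesis by (intro that[of "i < j"]) auto
  qed
qed

text \<open>The last hypothesis is the form of \<open>must_ask\<close> that passes to subtrees:
  pairs inside the current blocks have not been compared yet.\<close>

lemma adversary:
  assumes "position u w zs" "queries t \<subseteq> elems u w"
    and "\<And>h i j z. h \<in> choices u zs \<Longrightarrow> z \<in> set zs \<Longrightarrow> cell z i j \<Longrightarrow> flippable u h i j \<Longrightarrow>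
      asks t (interleaving h) (A i) (B j)"
  shows "\<exists>h\<in>choices u zs. (\<Sum>z\<leftarrow>zs. gain z) \<le> comparisons t (interleaving h)"
  using assms
proof (induction t arbitrary: zs)
  case (Output ws)
  obtain h where h: "h \<in> choices u zs"
    "\<And>z. z \<in> set zs \<Longrightarrow> gain z = 0 \<or> (\<exists>i j. cell z i j \<and> flippable u h i j)"
    using choice_exists[OF Output(1)] by metis
  then have "\<forall>z\<in>set zs. gain z = 0" using Output(3) by fastforce
  then have "(\<Sum>z\<leftarrow>zs. gain z) = 0" by (induction zs) auto
  then show ?case using h by auto
next
  case (Compare x y l r)
  \<comment> \<open>Common to unchanged and refined positions: the answer is forced and the compared
    pair lies in no block, so the obligation to ask passes to the chosen subtree.\<close>
  have branch: "\<exists>h\<in>choices u zs'. (\<Sum>z\<leftarrow>zs'. gain z) + 1 \<le> comparisons (Compare x y l r) (interleaving h)"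
    if pos': "position u w zs'" and sub: "choices u zs' \<subseteq> choices u zs"
      and c: "\<And>h. h \<in> choices u zs' \<Longrightarrow> (interleaving h x < interleaving h y) = c"
      and cells: "\<And>z' p q. z' \<in> set zs' \<Longrightarrow> cell z' p q \<Longrightarrow> {x, y} \<noteq> {A p, B q} \<and> (\<exists>z\<in>set zs. cell z p q)"
    for zs' c
  proof (cases c)
    case True
    have "asks l (interleaving h) (A p) (B q)"
      if q: "h \<in> choices u zs'" "z' \<in> set zs'" "cell z' p q" "flippable u h p q" for h z' p q
    proof -
      obtain z where "z \<in> set zs" "cell z p q" using cells[OF q(2,3)] by blast
      then have "asks (Compare x y l r) (interleaving h) (A p) (B q)"
        using Compare.prems(3) q(1,4) sub by blast
      then show ?thesis using c[OF q(1)] cells[OF q(2,3)] True by simp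
    qed
    moreover have "queries l \<subseteq> elems u w" using Compare.prems(2) by simp
    ultimately obtain h where "h \<in> choices u zs'" "(\<Sum>z\<leftarrow>zs'. gain z) \<le> comparisons l (interleaving h)"
      using Compare.IH(1)[OF pos'] by blast
    then show ?thesis using c True by (intro bexI[of _ h]) auto
  next
    case False
    have "asks r (interleaving h) (A p) (B q)"
      if q: "h \<in> choices u zs'" "z' \<in> set zs'" "cell z' p q" "flippable u h p q" for h z' p q
    proof -
      obtain z where "z \<in> set zs" "cell z p q" using cells[OF q(2,3)] by blast
      then have "asks (Compare x y l r) (interleaving h) (A p) (B q)"
        using Compare.prems(3) q(1,4) sub by blast
      then show ?thesis using c[OF q(1)] cells[OF q(2,3)] False by simp
    qed
    moreover have "queries r \<subseteq> elems u w" using Compare.prems(2) by simp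
    ultimately obtain h where "h \<in> choices u zs'" "(\<Sum>z\<leftarrow>zs'. gain z) \<le> comparisons r (interleaving h)"
      using Compare.IH(2)[OF pos'] by blast
    then show ?thesis using c False by (intro bexI[of _ h]) auto
  qed
  show ?case
  proof (cases "\<exists>i j z. {x, y} = {A i, B j} \<and> z \<in> set zs \<and> cell z i j")
    case False
    have xy: "x \<in> elems u w" "y \<in> elems u w" using Compare.prems(2) by auto
    obtain c where "\<And>h. h \<in> choices u zs \<Longrightarrow> (interleaving h x < interleaving h y) = c"
      using answer_fixed[OF Compare.prems(1) xy] False by metis
    then obtain h where "h \<in> choices u zs"
      "(\<Sum>z\<leftarrow>zs. gain z) + 1 \<le> comparisons (Compare x y l r) (interleaving h)"
      using branch[OF Compare.prems(1) order_refl] False by blast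
    then show ?thesis by (intro bexI[of _ h]) auto
  next
    case True
    then obtain i j z where ij: "{x, y} = {A i, B j}" "z \<in> set zs" "cell z i j" by blast
    then obtain xs ys where zs: "zs = xs @ z # ys" by (meson split_list)
    obtain z1 z2 c where ref: "position u w (xs @ z1 # z2 # ys)"
      "choices u (xs @ z1 # z2 # ys) \<subseteq> choices u (xs @ z # ys)"
      "\<And>h. h \<in> choices u (xs @ z1 # z2 # ys) \<Longrightarrow> (h i \<le> j) = c"
      "gain z \<le> gain z1 + gain z2 + 1"
      "\<And>p q. cell z1 p q \<or> cell z2 p q \<Longrightarrow> cell z p q \<and> (p, q) \<noteq> (i, j)"
      using refine_position[OF Compare.prems(1)[unfolded zs] ij(3)] by metis
    have eq: "{x, y} = {A p, B q} \<longleftrightarrow> (p, q) = (i, j)" for p q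
      using ij(1) by (auto simp: doubleton_eq_iff)
    have "row z i" using ij(3) by (cases z) auto
    then have others: "(p, q) \<noteq> (i, j)" if "z' \<in> set xs \<union> set ys" "cell z' p q" for z' p q
      using position_row_unique[OF Compare.prems(1)[unfolded zs] _ that(1)] that(2) by (cases z') auto
    have "\<exists>h\<in>choices u (xs @ z1 # z2 # ys).
        (\<Sum>z\<leftarrow>xs @ z1 # z2 # ys. gain z) + 1 \<le> comparisons (Compare x y l r) (interleaving h)"
    proof (rule branch)
      \<comment> \<open>\<open>c\<close> says whether \<open>A i\<close> is below
        \<open>B j\<close>; it is negated when \<open>x\<close> is the \<open>B\<close>.\<close>
      show "(interleaving h x < interleaving h y) = (if x = A i then c else \<not> c)"
        if "h \<in> choices u (xs @ z1 # z2 # ys)" for h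
        using ij(1) ref(3)[OF that] by (auto simp: doubleton_eq_iff)
      show "{x, y} \<noteq> {A p, B q} \<and> (\<exists>z\<in>set zs. cell z p q)"
        if z': "z' \<in> set (xs @ z1 # z2 # ys)" "cell z' p q" for z' p q
      proof (cases "z' \<in> set xs \<union> set ys")
        case True
        then show ?thesis using others[OF True z'(2)] z'(2) unfolding eq zs by auto
      next
        case False
        then have "cell z1 p q \<or> cell z2 p q" using z' by auto
        then show ?thesis using ref(5)[of p q] unfolding eq zs by auto
      qed
    qed (use ref zs in auto)
    then obtain h where h: "h \<in> choices u (xs @ z1 # z2 # ys)"
      "(\<Sum>z\<leftarrow>xs @ z1 # z2 # ys. gain z) + 1 \<le> comparisons (Compare x y l r) (interleaving h)"
      by blast
    have "(\<Sum>z\<leftarrow>zs. gain z) \<le> (\<Sum>z\<leftarrow>xs @ z1 # z2 # ys. gain z) + 1"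
      using ref(4) by (simp add: zs)
    moreover have "h \<in> choices u zs" using h(1) ref(2) zs by blast
    ultimately show ?thesis using h(2) by (intro bexI[of _ h]) linarith+
  qed
qed

lemma comparisons_lower_bound:
  assumes "forces False False m n 0" "merging_algorithm m n t"
  shows "\<exists>v\<in>inputs m n. m + n - 1 \<le> comparisons t v"
proof -
  let ?z = "(0, m, 0, n, False, False, 0)"
  have "position m n [?z]" using assms(1) by (auto simp: position_def)
  moreover have "queries t \<subseteq> elems m n" using assms(2) by (simp add: merging_algorithm_def)
  ultimately obtain h where "h \<in> choices m [?z]" "m + n - 1 \<le> comparisons t (interleaving h)"
    using adversary[of m n "[?z]" t] must_ask[OF assms(2)] by auto
  then show ?thesis using interleaving_input by (auto simp: choices_def)
qed

section \<open>Tape merge\<close>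

lemma tape_queries: "queries (tape out xs ys) \<subseteq> set xs \<union> set ys"
  by (induction out xs ys rule: tape.induct) auto

lemma tape_result:
  assumes "sorted_wrt (\<lambda>x y. v x < v y) (out @ xs)" "sorted_wrt (\<lambda>x y. v x < v y) (out @ ys)"
    and "\<And>x y. x \<in> set xs \<Longrightarrow> y \<in> set ys \<Longrightarrow> v x \<noteq> v y"
  shows "sorted_wrt (\<lambda>x y. v x < (v y :: real)) (result (tape out xs ys) v) \<and>
    set (result (tape out xs ys) v) = set out \<union> set xs \<union> set ys"
  using assms
proof (induction out xs ys rule: tape.induct)
  case (3 out x xs y ys)
  show ?case
  proof (cases "v x < v y")
    case True
    have "v x < v z" if "z \<in> set ys" for z
      using 3(4) that less_trans[OF True] by (simp add: sorted_wrt_append)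
    then have "sorted_wrt (\<lambda>x y. v x < v y) ((out @ [x]) @ y # ys)"
      using 3(3,4) True by (simp add: sorted_wrt_append)
    then have "sorted_wrt (\<lambda>x y. v x < v y) (result (tape (out @ [x]) xs (y # ys)) v) \<and>
        set (result (tape (out @ [x]) xs (y # ys)) v) = set (out @ [x]) \<union> set xs \<union> set (y # ys)"
      using 3(3,5) True by (intro 3(1)) simp_all
    then show ?thesis using True by auto
  next
    case False
    then have less: "v y < v x" using 3(5)[of x y] by simp
    have "v y < v z" if "z \<in> set xs" for z
      using 3(3) that less_trans[OF less] by (simp add: sorted_wrt_append)
    then have "sorted_wrt (\<lambda>x y. v x < v y) ((out @ [y]) @ x # xs)"
      using 3(3,4) less by (simp add: sorted_wrt_append)
    then have "sorted_wrt (\<lambda>x y. v x < v y) (result (tape (out @ [y]) (x # xs) ys) v) \<and>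
        set (result (tape (out @ [y]) (x # xs) ys) v) = set (out @ [y]) \<union> set (x # xs) \<union> set ys"
      using 3(4,5) False by (intro 3(2)) simp_all
    then show ?thesis using False by auto
  qed
qed auto

text \<open>Each comparison outputs one element, and at least one element remains when the other
  list runs out.\<close>

lemma tape_comparisons:
  "xs \<noteq> [] \<Longrightarrow> ys \<noteq> [] \<Longrightarrow> comparisons (tape out xs ys) v \<le> length xs + length ys - 1"
proof (induction out xs ys rule: tape.induct)
  case (3 out x xs y ys)
  then show ?case by (cases xs; cases ys) auto
qed auto

lemma tape_merge_correct: "merging_algorithm m n (tape_merge m n)"
  unfolding merging_algorithm_def tape_merge_def
proof (intro conjI ballI)
  show "queries (tape [] (map A [0..<m]) (map B [0..<n])) \<subseteq> elems m n"
    using tape_queries[of "[]" "map A [0..<m]" "map B [0..<n]"] by (auto simp: elems_def)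
  fix v assume v: "v \<in> inputs m n"
  have "v (A i) < v (A j)" if "i < j" "j < m" for i j
    using v that by (auto simp: inputs_def elim!: strict_mono_onD)
  moreover have "v (B i) < v (B j)" if "i < j" "j < n" for i j
    using v that by (auto simp: inputs_def elim!: strict_mono_onD)
  ultimately have "sorted_wrt (\<lambda>x y. v x < v y) (map A [0..<m])" "sorted_wrt (\<lambda>x y. v x < v y) (map B [0..<n])"
    by (simp_all add: sorted_wrt_iff_nth_less)
  moreover have "v x \<noteq> v y" if "x \<in> A ` {..<m}" "y \<in> B ` {..<n}" for x y
  proof -
    have "inj_on v (elems m n)" using v by (simp add: inputs_def)
    moreover have "x \<in> elems m n" "y \<in> elems m n" "x \<noteq> y" using that by (auto simp: elems_def)
    ultimately show ?thesis by (simp add: inj_on_eq_iff)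
  qed
  ultimately have "sorted_wrt (\<lambda>x y. v x < v y) (result (tape [] (map A [0..<m]) (map B [0..<n])) v) \<and>
      set (result (tape [] (map A [0..<m]) (map B [0..<n])) v) =
      set [] \<union> set (map A [0..<m]) \<union> set (map B [0..<n])"
    by (intro tape_result) (simp_all add: atLeast0LessThan)
  then show "set (result (tape [] (map A [0..<m]) (map B [0..<n])) v) = elems m n"
    "sorted_wrt (\<lambda>x y. v x < v y) (result (tape [] (map A [0..<m]) (map B [0..<n])) v)"
    by (auto simp: elems_def atLeast0LessThan)
qed

primrec height :: "algorithm \<Rightarrow> nat" where
  "height (Output xs) = 0"
| "height (Compare x y l r) = Suc (max (height l) (height r))"

lemma comparisons_le_height: "comparisons t v \<le> height t"
  by (induction t) auto

text \<open>There are infinitely many real-valued inputs, so the maximum in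
  \<open>worst_case\<close> needs the height of the tree as a bound.\<close>

lemma finite_comparisons: "finite (comparisons t ` X)"
  by (rule finite_subset[of _ "{..height t}"]) (auto simp: comparisons_le_height)

lemma worst_case_ge: "v \<in> inputs m n \<Longrightarrow> comparisons t v \<le> worst_case m n t"
  unfolding worst_case_def by (intro Max_ge finite_comparisons) auto

lemma tape_merge_worst_case:
  assumes "0 < m" "0 < n"
  shows "worst_case m n (tape_merge m n) \<le> m + n - 1"
  unfolding worst_case_def
proof (rule Max.boundedI[OF finite_comparisons])
  have "interleaving (\<lambda>_. 0) \<in> inputs m n" by (intro interleaving_input mono_onI) simp
  then show "comparisons (tape_merge m n) ` inputs m n \<noteq> {}" by blast
  fix c assume "c \<in> comparisons (tape_merge m n) ` inputs m n"
  then show "c \<le> m + n - 1"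
    using assms tape_comparisons[of "map A [0..<m]" "map B [0..<n]" "[]"] by (auto simp: tape_merge_def)
qed

theorem theorem1:
  fixes m n :: nat
  assumes "1 \<le> m" and "m \<le> n" and "real n \<le> 38 / 25 * real m"
  shows "M m n = m + n - 1 \<and>
         merging_algorithm m n (tape_merge m n) \<and> worst_case m n (tape_merge m n) = M m n"
proof -
  have "real (25 * n) \<le> real (38 * m)" using assms(3) by simp
  then have "25 * n \<le> 38 * m" unfolding of_nat_le_iff .
  \<comment> \<open>The bound for this case is 32, so the line through the origin lies inside the
    region.\<close>
  then have "region 0 0 (int m) (int n)" using assms(1,2) by (simp add: region_def bound_def)
  then have forces: "forces False False m n 0" by (intro forces_region) simp_all
  have lower: "m + n - 1 \<le> worst_case m n t" if t: "merging_algorithm m n t" for t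
    using comparisons_lower_bound[OF forces t] worst_case_ge order_trans by blast
  have upper: "worst_case m n (tape_merge m n) = m + n - 1"
    using tape_merge_worst_case[of m n] lower[OF tape_merge_correct] assms by simp
  have "M m n = m + n - 1"
    unfolding M_def
  proof (rule Least_equality)
    show "\<exists>t. merging_algorithm m n t \<and> worst_case m n t = m + n - 1"
      using tape_merge_correct upper by blast
  qed (use lower in blast)
  then show ?thesis using tape_merge_correct upper by simp
qed

end
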